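(* There is a unique real sequence $(c_n)_{n \in \mathbb{N}}$ such that $$\left(X^n - c_n\right) \in \mathscr{E}_2 \quad \text{for all } n \in \mathbb{N} .$$ Besides, we have $c_{2n} = 0$ for every positive integer $n$.
   Context: Here $\mathbb{N} = \{0, 1, 2, \dots\}$. $\mathscr{E}_2$ denotes the set (an $\mathbb{R}$-linear subspace of $\mathbb{R}[X]$) of all polynomials $P \in \mathbb{R}[X]$ for which the sum $P(n) + P(n-2) + P(n-4) + \cdots := \sum_{0 \leq k \leq n/2} P(n - 2k)$ (the sum over integers $k \ge 0$ with $n - 2k \geq 0$) is polynomial in $n \in \mathbb{N}$, i.e. there exists $S \in \mathbb{R}[X]$ such that this sum equals $S(n)$ for all $n \in \mathbb{N}$. *)

theory Defs
  imports Complex_Main "HOL-Computational_Algebra.Polynomial"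
begin

text \<open>The natural subtraction \<open>n - 2 * k\<close> never truncates, since \<open>2 * k \<le> n\<close> in the sum.\<close>

definition E2 :: "real poly set" where
  "E2 = {P. \<exists>S :: real poly. \<forall>n :: nat.
           (\<Sum>k | 2 * k \<le> n. poly P (real (n - 2 * k))) = poly S (real n)}"

end

theory Submission
  imports Defs
begin

text \<open>
  If \<open>T\<close> is a polynomial with \<open>T(x) - T(x - 2) = P(x)\<close>, the sum in the definition of \<open>E2\<close>
  telescopes to \<open>T(n) - T(-2)\<close> for even \<open>n\<close> and to \<open>T(n) - T(-1)\<close> for odd \<open>n\<close>, so that \<open>P\<close>
  belongs to \<open>E2\<close> as soon as \<open>T(-1) = T(-2)\<close>. Such a \<open>T\<close> always exists, and subtracting a
  constant from \<open>P\<close> changes \<open>T\<close> by a multiple of \<open>X\<close>, which can be used to enforce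
  \<open>T(-1) = T(-2)\<close>. For \<open>P = X^(2m)\<close> with \<open>m > 0\<close>, the polynomial \<open>T(x) + T(-2 - x)\<close> is
  2-periodic, hence constant; comparing its values at \<open>-1\<close> and \<open>-2\<close>, where
  \<open>T(0) = T(-2)\<close>, gives \<open>T(-1) = T(-2)\<close> without any correction.
\<close>

text \<open>A nonzero polynomial has finitely many roots. Even arguments are singled out because a
  sum of constants has a different formula at odd \<open>n\<close>, and 2-periodicity propagates a
  value only in steps of 2.\<close>

lemma poly_eqI_even_nats:
  fixes p q :: "real poly"
  assumes "\<And>k :: nat. poly p (2 * real k) = poly q (2 * real k)"
  shows "p = q"
proof (rule ccontr)
  assume "p \<noteq> q"
  then have "finite {x. poly (p - q) x = 0}"
    by (intro poly_roots_finite) simp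
  moreover have "range (\<lambda>k :: nat. 2 * real k) \<subseteq> {x. poly (p - q) x = 0}"
    using assms by auto
  moreover have "infinite (range (\<lambda>k :: nat. 2 * real k))"
    by (intro range_inj_infinite) (auto simp: inj_on_def)
  ultimately show False
    using finite_subset by blast
qed

lemma step2_sum_1: "(\<Sum>k | 2 * k \<le> Suc 0. f (Suc 0 - 2 * k)) = f (Suc 0)"
proof -
  have "{k :: nat. 2 * k \<le> Suc 0} = {0}" by auto
  then show ?thesis by simp
qed

lemma step2_sum_Suc_Suc:
  "(\<Sum>k | 2 * k \<le> Suc (Suc n). f (Suc (Suc n) - 2 * k)) =
     f (Suc (Suc n)) + (\<Sum>k | 2 * k \<le> n. f (n - 2 * k))"
proof -
  have *: "{k. 2 * k \<le> Suc (Suc n)} = insert 0 (Suc ` {k. 2 * k \<le> n})"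
  proof (intro set_eqI iffI)
    fix k assume "k \<in> {k. 2 * k \<le> Suc (Suc n)}"
    then show "k \<in> insert 0 (Suc ` {k. 2 * k \<le> n})"
      by (cases k) auto
  qed auto
  have "finite {k. 2 * k \<le> n}"
    by (rule finite_subset[of _ "{..n}"]) auto
  then show ?thesis
    unfolding * by (simp add: sum.reindex)
qed

lemma E2_if_telescoping:
  fixes P T :: "real poly"
  assumes step: "\<And>x. poly T x - poly T (x - 2) = poly P x"
    and bdry: "poly T (-1) = poly T (-2)"
  shows "P \<in> E2"
proof -
  have "(\<Sum>k | 2 * k \<le> n. poly P (real (n - 2 * k))) = poly (T - [:poly T (-2):]) (real n)" for n
  proof (induction n rule: induct_nat_012)
    case 0
    show ?case using step[of 0] by simp
  next
    case 1
    show ?case using step[of 1] bdry step2_sum_1[of "\<lambda>m. poly P (real m)"] by simp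
  next
    case (ge2 n)
    show ?case
      using step[of "real (Suc (Suc n))"] ge2.IH(1) step2_sum_Suc_Suc[of "\<lambda>m. poly P (real m)" n]
      by simp
  qed
  then show ?thesis unfolding E2_def by blast
qed

lemma E2_diff:
  assumes "P \<in> E2" "Q \<in> E2"
  shows "P - Q \<in> E2"
proof -
  from assms obtain S T where
    "\<forall>n. (\<Sum>k | 2 * k \<le> n. poly P (real (n - 2 * k))) = poly S (real n)"
    "\<forall>n. (\<Sum>k | 2 * k \<le> n. poly Q (real (n - 2 * k))) = poly T (real n)"
    unfolding E2_def by blast
  then have "\<forall>n. (\<Sum>k | 2 * k \<le> n. poly (P - Q) (real (n - 2 * k))) = poly (S - T) (real n)"
    by (simp add: sum_subtractf)
  then show ?thesis unfolding E2_def by blast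
qed

text \<open>Even \<open>n\<close> force \<open>S\<close> to be \<open>a + (a / 2) X\<close>, whose
  value \<open>3 * a / 2\<close> at 1 must equal the one-term sum \<open>a\<close>.\<close>

lemma const_in_E2_imp_zero:
  assumes "[:a:] \<in> E2"
  shows "a = 0"
proof -
  from assms obtain S where
    S: "\<And>n. (\<Sum>k | 2 * k \<le> n. poly [:a:] (real (n - 2 * k))) = poly S (real n)"
    unfolding E2_def by blast
  have "poly S (2 * real k) = poly [:a, a / 2:] (2 * real k)" for k
  proof -
    have "{j. 2 * j \<le> 2 * k} = {..k}" by auto
    with S[of "2 * k"] show ?thesis by (simp add: algebra_simps)
  qed
  then have "S = [:a, a / 2:]" by (rule poly_eqI_even_nats)
  moreover have "poly S 1 = a"
    using S[of 1] step2_sum_1[of "\<lambda>_. a"] by simp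
  ultimately show ?thesis by simp
qed

lemma minus_const_in_E2_unique:
  assumes "P - [:a:] \<in> E2" "P - [:b:] \<in> E2"
  shows "a = b"
proof -
  have "[:b - a:] = (P - [:a:]) - (P - [:b:])" by simp
  then have "[:b - a:] \<in> E2" using E2_diff[OF assms] by metis
  then show ?thesis using const_in_E2_imp_zero by fastforce
qed

text \<open>
  The rising products \<open>B k = x (x + 2) \<dots> (x + 2 (k - 1))\<close> satisfy
  \<open>B (k + 1) (x) - B (k + 1) (x - 2) = 2 (k + 1) B k (x)\<close>, and \<open>x B k = B (k + 1) - 2 k B k\<close>
  lowers the power of \<open>x\<close> in front.
\<close>

lemma power_times_rising_antidifference:
  "\<exists>T :: real poly. \<forall>x. poly T x - poly T (x - 2) = x ^ n * (\<Prod>i<k. x + 2 * real i)"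
proof (induction n arbitrary: k)
  case 0
  have shift: "(\<Prod>i<Suc k. x - 2 + 2 * real i) = (x - 2) * (\<Prod>i<k. x + 2 * real i)" for x
    by (subst prod.lessThan_Suc_shift) (simp add: algebra_simps)
  have poly_rising: "poly (\<Prod>i<m. [:2 * real i, 1:]) x = (\<Prod>i<m. x + 2 * real i)" for m x
    by (simp add: poly_prod add.commute)
  let ?T = "smult (1 / (2 * real k + 2)) (\<Prod>i<Suc k. [:2 * real i, 1:])"
  have "poly ?T x - poly ?T (x - 2) =
      ((x + 2 * real k) * (\<Prod>i<k. x + 2 * real i) - (x - 2) * (\<Prod>i<k. x + 2 * real i)) /
        (2 * real k + 2)" for x
    unfolding poly_smult poly_rising shift by (simp add: diff_divide_distrib mult.commute)
  then have "poly ?T x - poly ?T (x - 2) = (\<Prod>i<k. x + 2 * real i)" for x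
    by (simp flip: left_diff_distrib)
  then show ?case by (intro exI[of _ ?T]) simp
next
  case (Suc n)
  obtain T U :: "real poly" where
    T: "\<And>x. poly T x - poly T (x - 2) = x ^ n * (\<Prod>i<Suc k. x + 2 * real i)" and
    U: "\<And>x. poly U x - poly U (x - 2) = x ^ n * (\<Prod>i<k. x + 2 * real i)"
    using Suc.IH by metis
  let ?V = "T - smult (2 * real k) U"
  have "poly ?V x - poly ?V (x - 2) =
      (poly T x - poly T (x - 2)) - 2 * real k * (poly U x - poly U (x - 2))" for x
    by (simp add: algebra_simps)
  then have "poly ?V x - poly ?V (x - 2) = x ^ Suc n * (\<Prod>i<k. x + 2 * real i)" for x
    unfolding T U by (simp add: algebra_simps)
  then show ?case by blast
qed

lemma monom_antidifference:
  obtains T :: "real poly" where "\<And>x. poly T x - poly T (x - 2) = x ^ n"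
  using power_times_rising_antidifference[of n 0] by auto

lemma monom_minus_const_in_E2: "\<exists>c. monom 1 n - [:c:] \<in> E2"
proof -
  obtain T :: "real poly" where T: "\<And>x. poly T x - poly T (x - 2) = x ^ n"
    using monom_antidifference by blast
  \<comment> \<open>The values of \<open>?d * X\<close> at -1 and -2 differ by exactly
    \<open>?d\<close>, so subtracting it from \<open>T\<close> makes the boundary values agree; its
    increment over a step of 2 is \<open>2 * ?d\<close>.\<close>
  let ?d = "poly T (-1) - poly T (-2)"
  have "monom 1 n - [:2 * ?d:] \<in> E2"
  proof (rule E2_if_telescoping)
    show "poly (T - [:0, ?d:]) x - poly (T - [:0, ?d:]) (x - 2) =
        poly (monom 1 n - [:2 * ?d:]) x" for x
      using T[of x] by (simp add: poly_monom algebra_simps)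
  qed (simp add: algebra_simps)
  then show ?thesis by blast
qed

lemma monom_even_in_E2:
  assumes "n > 0"
  shows "monom 1 (2 * n) \<in> E2"
proof -
  obtain T :: "real poly" where T: "\<And>x. poly T x - poly T (x - 2) = x ^ (2 * n)"
    using monom_antidifference by blast
  \<comment> \<open>The reflection \<open>-2 - x\<close> fixes -1 and swaps 0 with -2.\<close>
  let ?p = "T + pcompose T [:-2, -1:]"
  have p: "poly ?p x = poly T x + poly T (-2 - x)" for x
    by (simp add: poly_pcompose)
  have periodic: "poly ?p (x + 2) = poly ?p x" for x
  proof -
    \<comment> \<open>From \<open>x\<close> to \<open>x + 2\<close> the first summand gains
      \<open>(x + 2) ^ (2 * n)\<close> and the reflected one loses
      \<open>(-2 - x) ^ (2 * n)\<close>; the even exponent makes these cancel.\<close>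
    have "(-2 - x) ^ (2 * n) = (x + 2) ^ (2 * n)"
      using power_minus_even[of "2 * n" "x + 2"] by (simp add: minus_diff_commute)
    then show ?thesis
      using T[of "x + 2"] T[of "-2 - x"] unfolding p by (simp add: algebra_simps)
  qed
  have "poly ?p (2 * real k) = poly [:poly ?p 0:] (2 * real k)" for k
  proof (induction k)
    case (Suc k)
    then show ?case using periodic[of "2 * real k"] by (simp add: add.commute)
  qed simp
  then have "?p = [:poly ?p 0:]" by (rule poly_eqI_even_nats)
  then obtain a where a: "?p = [:a:]" by blast
  have "poly ?p (-1) = poly ?p (-2)" unfolding a by simp
  \<comment> \<open>Positivity of \<open>n\<close> enters here, through
    \<open>0 ^ (2 * n) = 0\<close>.\<close>
  moreover have "poly T 0 = poly T (-2)" using T[of 0] assms by (simp add: zero_power)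
  ultimately have "poly T (-1) = poly T (-2)" unfolding p by simp
  with T show ?thesis by (intro E2_if_telescoping[of T]) (simp_all add: poly_monom)
qed

theorem corollary2p4:
  shows "(\<exists>!c :: nat \<Rightarrow> real. \<forall>n. monom 1 n - [:c n:] \<in> E2) \<and>
         (\<forall>c :: nat \<Rightarrow> real. (\<forall>n. monom 1 n - [:c n:] \<in> E2) \<longrightarrow> (\<forall>n>0. c (2 * n) = 0))"
proof (intro conjI ex_ex1I allI impI)
  show "\<exists>c :: nat \<Rightarrow> real. \<forall>n. monom 1 n - [:c n:] \<in> E2"
    using monom_minus_const_in_E2 by (intro choice) blast
next
  fix c d :: "nat \<Rightarrow> real"
  assume "\<forall>n. monom 1 n - [:c n:] \<in> E2" "\<forall>n. monom 1 n - [:d n:] \<in> E2"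
  then show "c = d" using minus_const_in_E2_unique by blast
next
  fix c :: "nat \<Rightarrow> real" and n :: nat
  assume "\<forall>n. monom 1 n - [:c n:] \<in> E2" and "n > 0"
  then have "monom 1 (2 * n) - [:c (2 * n):] \<in> E2" "monom 1 (2 * n) - [:0:] \<in> E2"
    using monom_even_in_E2 by auto
  then show "c (2 * n) = 0" by (rule minus_const_in_E2_unique)
qed

end
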